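(* Let $D$ be a $\kappa$-connected strong digraph of order $n$ and size $m$, with $$\frac{n}{2}(3\kappa+n)-n-\kappa^2-b(\kappa-b)\le m\le n^2-2n-1,$$ where $b\in\{1,2,\ldots,\kappa\}$ with $b\equiv n-1\pmod{\kappa}$. Let $m^*$ be the smallest integer with $m^*\ge m$ and $m^*\equiv (n^2-2n-1)\pmod{\kappa}$. Then $$\rho(D)\le \frac{n}{\kappa}+2-\frac{1}{\kappa}-\frac{\kappa-1}{n-1}-\frac{m^*}{\kappa(n-1)},$$ and this bound is sharp.
   Context: Here $\kappa$ is a positive integer. Digraphs are finite, without loops or multiple arcs (opposite arcs are allowed). The order is the number of vertices and the size is the number of arcs. A digraph is strong if for every ordered pair $u,v$ of vertices there is a directed path from $u$ to $v$. The vertex-connectivity of a digraph is the minimum number of vertices whose removal results in a digraph that is not strong; a digraph is $\kappa$-connected if its vertex-connectivity is at least $\kappa$. For a strong digraph $D$ of order $n\ge 2$ and $v\in V(D)$, let $\overline{\sigma}(v,D)=\frac{1}{n-1}\sum_{w\in V(D)} d_D(v,w)$, where $d_D(v,w)$ is the length of a shortest directed path from $v$ to $w$. The remoteness is $\rho(D)=\max_{v\in V(D)}\overline{\sigma}(v,D)$.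
   Formalization: m* is taken ≡ n²−2n+1 (mod κ), since the printed class fails for κ=3, n=9, m=61; sharpness is claimed for each m with m* ≥ (n/2)(3κ+n)−n−κ²−(κ−1+b(κ−b))/2, as below this the bound is not attained (e.g. κ=12, n=30, m=781). *)

theory Defs
  imports Complex_Main "HOL-Number_Theory.Cong" "Graph_Theory.Graph_Theory"
begin

text \<open>
  The locale predicate \<^const>\<open>digraph\<close> describes finite digraphs without loops or multiple
  arcs; opposite arcs are allowed.
\<close>

text \<open>
  The empty digraph is not \<^const>\<open>strongly_connected\<close>, so the set below always contains
  \<^term>\<open>card (verts G)\<close>. This matters for complete digraphs only: the vertex-connectivity
  of the complete digraph on n vertices is n here, where other authors put n - 1.
\<close>

definition vertex_connectivity :: "('a, 'b) pre_digraph \<Rightarrow> nat" where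
  "vertex_connectivity G =
     (LEAST k. \<exists>S \<subseteq> verts G. card S = k \<and> \<not> strongly_connected (G \<restriction> (verts G - S)))"

definition connected_of_degree :: "nat \<Rightarrow> ('a, 'b) pre_digraph \<Rightarrow> bool" where
  "connected_of_degree \<kappa> G \<longleftrightarrow> \<kappa> \<le> vertex_connectivity G"

definition distance :: "('a, 'b) pre_digraph \<Rightarrow> 'a \<Rightarrow> 'a \<Rightarrow> nat" where
  "distance G v w = (LEAST k. \<exists>p. pre_digraph.apath G v p w \<and> length p = k)"

definition average_distance_from :: "('a, 'b) pre_digraph \<Rightarrow> 'a \<Rightarrow> real" where
  "average_distance_from G v =
     1 / (real (card (verts G)) - 1) * (\<Sum>w\<in>verts G. real (distance G v w))"

definition remoteness :: "('a, 'b) pre_digraph \<Rightarrow> real" where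
  "remoteness G = Max (average_distance_from G ` verts G)"

text \<open>
  If n - 1 is a positive multiple of \<kappa> plus b, the following is the number of arcs of the digraph
  of order n with consecutive layers of sizes 1, \<kappa>, ..., \<kappa>, b in which an arc from x to y
  is missing exactly if y lies two or more layers after x. It is the largest size of a
  \<kappa>-connected digraph whose remoteness is the maximum possible for the order n.
\<close>

definition longest_layered_size :: "nat \<Rightarrow> nat \<Rightarrow> nat \<Rightarrow> real" where
  "longest_layered_size \<kappa> n b =
     real n / 2 * (3 * real \<kappa> + real n) - real n - (real \<kappa>)\<^sup>2
       - (real \<kappa> - 1 + real b * (real \<kappa> - real b)) / 2"

definition remoteness_bound :: "nat \<Rightarrow> nat \<Rightarrow> int \<Rightarrow> real" where
  "remoteness_bound \<kappa> n m =
     real n / real \<kappa> + 2 - 1 / real \<kappa> - (real \<kappa> - 1) / (real n - 1)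
       - real_of_int m / (real \<kappa> * (real n - 1))"

text \<open>
  The residue class of m* below is that of \<open>n\<^sup>2 - 2 * n + 1 = (n - 1)\<^sup>2\<close>.
  The source prints \<open>n\<^sup>2 - 2 * n - 1\<close>, which makes the
  bound false for \<open>\<kappa> = 3\<close>, \<open>n = 9\<close>, \<open>m = 61\<close>: the digraph with layers of sizes
  1, 3, 3, 2 and no arc skipping a layer forwards has remoteness 15/8, while the printed bound
  is 11/6. The two classes agree for \<open>\<kappa> \<le> 2\<close>. For \<open>\<kappa> \<ge> 3\<close> the
  printed class makes the bound times n - 1 a non-integer, so that it is never attained.
\<close>

definition rounded_size :: "nat \<Rightarrow> nat \<Rightarrow> nat \<Rightarrow> int" where
  "rounded_size \<kappa> n m =
     (LEAST k. int m \<le> k \<and> [k = (int n)\<^sup>2 - 2 * int n + 1] (mod int \<kappa>))"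

end

theory Submission
  imports Defs
begin

text \<open>
  Write N = n - 1 and let \<open>\<sigma>\<close> be the sum of the distances from v. All distance layers of v
  strictly between the first and the last one are separators, hence have at least \<open>\<kappa>\<close>
  vertices, and no arc leads from a layer i to a layer \<open>j \<ge> i + 2\<close>. So a vertex at distance
  \<open>j \<ge> 2\<close> misses at least \<open>1 + \<kappa> * (j - 2)\<close> incoming arcs, and summing gives
  \<open>m \<le> N\<^sup>2 + \<kappa> * (2 * N - \<kappa> + 1 - \<sigma>)\<close>. The right-hand side lies in the residue class of
  \<open>N\<^sup>2\<close> modulo \<open>\<kappa>\<close>, so m may be replaced by m*, which is the bound.
  Equality with m* holds for the digraph with all non-skipping arcs whenever all layers except
  the first and the last two have exactly \<open>\<kappa>\<close> vertices, and such layerings realise every value of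
  \<open>\<sigma>\<close> up to the maximum. The surplus of \<open>m* - m < \<kappa>\<close> arcs is removed among the arcs into v
  that do not start in layer 1; this affects neither the distances from v nor the
  \<open>\<kappa>\<close>-connectivity.
\<close>

section \<open>Distances\<close>

context wf_digraph
begin

text \<open>Each round of \<open>awalk_to_apath\<close> cuts a closed subwalk \<open>r\<close> out
  of \<open>q @ r @ s\<close>, so lengths can only drop. In this way arbitrary walks bound
  \<open>distance\<close>, which is defined by paths alone.\<close>

lemma length_awalk_to_apath_le:
  assumes "awalk u p v"
  shows "length (awalk_to_apath p) \<le> length p"
  using assms
proof (induct rule: awalk_to_apath_induct)
  case (path p)
  then have "awalk_to_apath p = p"
    by (auto simp: awalk_to_apath.simps)
  then show ?case by simp
next
  case (decomp p q r s)
  then have "awalk_to_apath p = awalk_to_apath (q @ s)"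
    using step_awalk_to_apath by blast
  moreover have "p = q @ r @ s"
    using decomp by (metis awalk_cyc_decomp_has_prop is_awalk_cyc_decomp.simps)
  ultimately show ?case using decomp by simp
qed

lemma ex_apath_distance:
  assumes "u \<rightarrow>\<^sup>* v"
  shows "\<exists>p. apath u p v \<and> length p = distance G u v"
proof -
  obtain p where "awalk u p v" using assms reachable_awalk by blast
  then have "\<exists>k p. apath u p v \<and> length p = k" using apath_awalk_to_apath by blast
  then show ?thesis unfolding distance_def by (rule LeastI_ex)
qed

lemma distance_le_length:
  assumes "awalk u p v"
  shows "distance G u v \<le> length p"
proof -
  have "distance G u v \<le> length (awalk_to_apath p)"
    unfolding distance_def by (rule Least_le) (use assms apath_awalk_to_apath in blast)
  then show ?thesis using length_awalk_to_apath_le[OF assms] by simp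
qed

lemma distance_step:
  assumes "u \<rightarrow>\<^sup>* x" "x \<rightarrow>\<^bsub>G\<^esub> y"
  shows "distance G u y \<le> distance G u x + 1"
proof -
  obtain p where p: "apath u p x" "length p = distance G u x"
    using ex_apath_distance assms(1) by blast
  obtain e where e: "e \<in> arcs G" "tail G e = x" "head G e = y" using assms(2) by blast
  have "awalk x [e] y" using e by (auto simp: awalk_def)
  then have "awalk u (p @ [e]) y" using p by (auto simp: apath_def)
  from distance_le_length[OF this] show ?thesis using p by simp
qed

lemma distance_refl: "u \<in> verts G \<Longrightarrow> distance G u u = 0"
  using distance_le_length[of u "[]" u] by (simp add: awalk_Nil_iff)

lemma distance_eq_0_iff:
  assumes "u \<rightarrow>\<^sup>* v"
  shows "distance G u v = 0 \<longleftrightarrow> u = v"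
proof
  assume "distance G u v = 0"
  then show "u = v" using ex_apath_distance[OF assms] by (auto simp: apath_Nil_iff)
next
  assume "u = v"
  then show "distance G u v = 0" using reachable_in_verts(1)[OF assms] distance_refl by simp
qed

lemma potential_le_awalk:
  fixes f :: "'a \<Rightarrow> nat"
  assumes "awalk u p v" and "\<And>x y. x \<rightarrow>\<^bsub>G\<^esub> y \<Longrightarrow> f y \<le> f x + 1"
  shows "f v \<le> f u + length p"
  using assms(1)
proof (induct p arbitrary: u)
  case Nil
  then show ?case by (simp add: awalk_Nil_iff)
next
  case (Cons e p)
  then have e: "e \<in> arcs G" "tail G e = u" "awalk (head G e) p v"
    by (auto simp: awalk_Cons_iff)
  then have "u \<rightarrow>\<^bsub>G\<^esub> head G e" by (auto simp: arcs_ends_conv)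
  then show ?case using assms(2)[of u "head G e"] Cons.hyps[OF e(3)] by simp
qed

text \<open>The tool for lower bounds on distances: with the layer index as \<open>f\<close>, no
  shortest path has to be computed.\<close>

lemma potential_le_distance:
  fixes f :: "'a \<Rightarrow> nat"
  assumes "u \<rightarrow>\<^sup>* v" and "\<And>x y. x \<rightarrow>\<^bsub>G\<^esub> y \<Longrightarrow> f y \<le> f x + 1"
  shows "f v \<le> f u + distance G u v"
proof -
  obtain p where "apath u p v" "length p = distance G u v"
    using ex_apath_distance[OF assms(1)] by blast
  then show ?thesis using potential_le_awalk[of u p v f] assms(2) awalkI_apath by simp
qed

end

section \<open>Layers and vertex-connectivity\<close>

lemma vertex_connectivity_le:
  assumes "S \<subseteq> verts G" "\<not> strongly_connected (G \<restriction> (verts G - S))"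
  shows "vertex_connectivity G \<le> card S"
  unfolding vertex_connectivity_def by (rule Least_le) (use assms in blast)

text \<open>Deleting every vertex leaves the empty digraph, which is not strongly connected.\<close>

lemma vertex_connectivity_le_order: "vertex_connectivity G \<le> card (verts G)"
  by (rule vertex_connectivity_le) (auto simp: strongly_connected_def)

lemma le_vertex_connectivityI:
  assumes "\<And>S. S \<subseteq> verts G \<Longrightarrow> card S < \<kappa> \<Longrightarrow> strongly_connected (G \<restriction> (verts G - S))"
  shows "\<kappa> \<le> vertex_connectivity G"
proof -
  let ?P = "\<lambda>k. \<exists>S\<subseteq>verts G. card S = k \<and> \<not> strongly_connected (G \<restriction> (verts G - S))"
  have "\<exists>k. ?P k"
    by (rule exI[of _ "card (verts G)"], rule exI[of _ "verts G"])
      (auto simp: strongly_connected_def)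
  then have "?P (vertex_connectivity G)" unfolding vertex_connectivity_def by (rule LeastI_ex)
  then obtain S where "S \<subseteq> verts G" "card S = vertex_connectivity G"
    "\<not> strongly_connected (G \<restriction> (verts G - S))" by blast
  then show ?thesis using assms[of S] by (auto simp: not_less[symmetric])
qed

text \<open>A walk starting below layer \<open>i\<close> cannot jump over it, since \<open>f\<close>
  rises by at most one per arc. Once the layer is deleted, the walk stays below \<open>i\<close> and
  never reaches \<open>w\<close>.\<close>

lemma (in wf_digraph) vertex_connectivity_le_card_layer:
  fixes f :: "'a \<Rightarrow> nat"
  assumes f: "\<And>x y. x \<rightarrow>\<^bsub>G\<^esub> y \<Longrightarrow> f y \<le> f x + 1"
    and uw: "u \<in> verts G" "w \<in> verts G" "f u < i" "i < f w"
  shows "vertex_connectivity G \<le> card {x \<in> verts G. f x = i}"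
proof (rule vertex_connectivity_le)
  let ?A = "verts G - {x \<in> verts G. f x = i}"
  let ?H = "G \<restriction> ?A"
  interpret H: wf_digraph ?H by (rule wellformed_induce_subgraph)
  show "\<not> strongly_connected ?H"
  proof
    assume "strongly_connected ?H"
    then have "u \<rightarrow>\<^sup>*\<^bsub>?H\<^esub> w" using uw by (auto simp: strongly_connected_def)
    then have "f w < i"
    proof (induct rule: H.reachable_induct)
      case base
      then show ?case using uw by simp
    next
      case (step x y)
      from step(2) have "f y \<le> f x + 1" by (rule f[OF dominates_induce_subgraphD])
      moreover have "f y \<noteq> i" using H.adj_in_verts[OF step(2)] by simp
      ultimately show ?case using step(3) by simp
    qed
    then show False using uw by simp
  qed
qed simp

section \<open>Counting arcs\<close>

lemma card_arcs_ends: "digraph G \<Longrightarrow> card (arcs_ends G) = card (arcs G)"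
  unfolding arcs_ends_def
  by (rule card_image) (simp add: digraph_def nomulti_digraph.inj_on_arc_to_ends)

lemma card_off_diagonal:
  assumes "finite V"
  shows "card (V \<times> V - Id) = card V * card V - card V"
proof -
  have "card (Id_on V) = card V"
    unfolding Id_on_def by (subst card_UN_disjoint) (use assms in auto)
  moreover have "V \<times> V - Id = V \<times> V - Id_on V" by auto
  moreover have "Id_on V \<subseteq> V \<times> V" by auto
  ultimately show ?thesis using assms
    by (simp add: card_Diff_subset finite_subset card_cartesian_product)
qed

definition skips :: "'a set \<Rightarrow> ('a \<Rightarrow> nat) \<Rightarrow> ('a \<times> 'a) set" where
  "skips V f = {(x, y) \<in> V \<times> V. f x + 2 \<le> f y}"

text \<open>Count by the head \<open>y\<close>. Restricting to \<open>2 \<le> f y\<close> keeps the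
  truncated \<open>f y - 2\<close> from counting layer 0 for heads in layers 0 and 1.\<close>

lemma card_skips:
  assumes "finite V"
  shows "card (skips V f) = (\<Sum>y\<in>{y \<in> V. 2 \<le> f y}. card {x \<in> V. f x \<le> f y - 2})"
proof -
  have "skips V f = prod.swap ` (SIGMA y:{y \<in> V. 2 \<le> f y}. {x \<in> V. f x \<le> f y - 2})"
    by (force simp: skips_def image_iff)
  then have "card (skips V f) = card (SIGMA y:{y \<in> V. 2 \<le> f y}. {x \<in> V. f x \<le> f y - 2})"
    by (simp add: card_image)
  then show ?thesis using assms by simp
qed

lemma card_potential_pairs:
  assumes "finite V"
  shows "int (card {(x, y) \<in> V \<times> V. x \<noteq> y \<and> f y \<le> f x + 1})
    = int (card V) * int (card V) - int (card V) - int (card (skips V f))"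
proof -
  have "{(x, y) \<in> V \<times> V. x \<noteq> y \<and> f y \<le> f x + 1} = (V \<times> V - Id) - skips V f"
    by (auto simp: skips_def)
  moreover have "skips V f \<subseteq> V \<times> V - Id" by (auto simp: skips_def)
  moreover have "finite (V \<times> V - Id)" using assms by simp
  ultimately have "int (card {(x, y) \<in> V \<times> V. x \<noteq> y \<and> f y \<le> f x + 1})
    = int (card (V \<times> V - Id)) - int (card (skips V f))"
    by (simp add: card_Diff_subset finite_subset card_mono of_nat_diff)
  then show ?thesis using assms by (simp add: card_off_diagonal of_nat_diff)
qed

text \<open>The summand is affine in \<open>f y\<close>: sum it over all of \<open>V\<close>, then
  take off \<open>1 - 2 * \<kappa>\<close> for the vertex of layer 0 and \<open>1 - \<kappa>\<close>
  for each vertex of layer 1. The formula serves both the upper bound and the exact count in the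
  construction.\<close>

lemma sum_above_layer_one:
  fixes f :: "'a \<Rightarrow> nat" and \<kappa> :: int
  assumes "finite V" "card {y \<in> V. f y = 0} = 1"
  shows "(\<Sum>y\<in>{y \<in> V. 2 \<le> f y}. 1 + \<kappa> * (int (f y) - 2))
    = (int (card V) - 1) + \<kappa> * (\<Sum>y\<in>V. int (f y)) - 2 * \<kappa> * (int (card V) - 1)
      + (\<kappa> - 1) * int (card {y \<in> V. f y = 1})"
proof -
  let ?g = "\<lambda>y. 1 + \<kappa> * (int (f y) - 2)"
  have V: "V = {y \<in> V. f y = 0} \<union> {y \<in> V. f y = 1} \<union> {y \<in> V. 2 \<le> f y}" by auto
  have "(\<Sum>y\<in>V. ?g y) = (\<Sum>y\<in>{y \<in> V. f y = 0}. ?g y) + (\<Sum>y\<in>{y \<in> V. f y = 1}. ?g y)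
      + (\<Sum>y\<in>{y \<in> V. 2 \<le> f y}. ?g y)"
  proof -
    have "sum ?g V = sum ?g ({y \<in> V. f y = 0} \<union> {y \<in> V. f y = 1}) + sum ?g {y \<in> V. 2 \<le> f y}"
      by (subst V, rule sum.union_disjoint) (use assms(1) in auto)
    also have "sum ?g ({y \<in> V. f y = 0} \<union> {y \<in> V. f y = 1})
        = sum ?g {y \<in> V. f y = 0} + sum ?g {y \<in> V. f y = 1}"
      by (rule sum.union_disjoint) (use assms(1) in auto)
    finally show ?thesis .
  qed
  moreover have "(\<Sum>y\<in>{y \<in> V. f y = 0}. ?g y) = 1 - 2 * \<kappa>" using assms(2) by simp
  moreover have "(\<Sum>y\<in>{y \<in> V. f y = 1}. ?g y) = (1 - \<kappa>) * int (card {y \<in> V. f y = 1})"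
    by simp
  moreover have "(\<Sum>y\<in>V. ?g y)
      = int (card V) + \<kappa> * ((\<Sum>y\<in>V. int (f y)) - 2 * int (card V))"
    by (simp add: sum.distrib sum_subtractf flip: sum_distrib_left)
  ultimately show ?thesis by (simp add: algebra_simps)
qed

section \<open>The upper bound\<close>

text \<open>If some vertex is at distance two or more, count skipping pairs; otherwise the factor
  after \<open>int \<kappa>\<close> is nonnegative and \<open>m\<close> gives the claim.\<close>

lemma size_le_of_distance_sum:
  assumes G: "digraph G" "strongly_connected G" "\<kappa> \<le> vertex_connectivity G" "1 \<le> \<kappa>"
    and v: "v \<in> verts G" and m: "int (card (arcs G)) \<le> (int (card (verts G)) - 1)\<^sup>2"
  shows "int (card (arcs G)) \<le> (int (card (verts G)) - 1)\<^sup>2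
    + int \<kappa> * (2 * (int (card (verts G)) - 1) - int \<kappa> + 1 - (\<Sum>w\<in>verts G. int (distance G v w)))"
proof -
  interpret digraph G by fact
  define f where "f = distance G v"
  define V where "V = verts G"
  define N where "N = int (card V) - 1"
  have finV: "finite V" unfolding V_def by simp
  have reach: "v \<rightarrow>\<^sup>*\<^bsub>G\<^esub> w" if "w \<in> V" for w
    using that v G(2) by (simp add: V_def strongly_connected_def)
  have f0: "f w = 0 \<longleftrightarrow> v = w" if "w \<in> V" for w
    using that reach distance_eq_0_iff by (simp add: f_def)
  have step: "f y \<le> f x + 1" if "x \<rightarrow>\<^bsub>G\<^esub> y" for x y
    using that distance_step reach adj_in_verts by (auto simp: f_def V_def)
  have zero: "{y \<in> V. f y = 0} = {v}" using f0 v by (auto simp: V_def)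
  have arcs_le: "int (card (arcs G)) \<le> (N + 1) * N - int (card (skips V f))"
  proof -
    have "arcs_ends G \<subseteq> {(x, y) \<in> V \<times> V. x \<noteq> y \<and> f y \<le> f x + 1}"
      using step adj_in_verts adj_not_same by (fastforce simp: V_def)
    then have "card (arcs_ends G) \<le> card {(x, y) \<in> V \<times> V. x \<noteq> y \<and> f y \<le> f x + 1}"
      by (rule card_mono[rotated]) (use finV in \<open>auto intro: finite_subset[of _ "V \<times> V"]\<close>)
    then show ?thesis
      using card_potential_pairs[OF finV, of f] card_arcs_ends[OF G(1)]
      by (simp add: N_def algebra_simps)
  qed
  have "int (card (arcs G)) \<le> N\<^sup>2 + int \<kappa> * (2 * N - int \<kappa> + 1 - (\<Sum>w\<in>V. int (f w)))"
  proof (cases "\<exists>w\<in>V. 2 \<le> f w")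
    case True
    have layer: "\<kappa> \<le> card {x \<in> V. f x = i}" if "w \<in> V" "0 < i" "i < f w" for w i
      using vertex_connectivity_le_card_layer[of f v w i] step that v f0 G(3)
      by (fastforce simp: V_def)
    \<comment> \<open>Layer 0 contributes 1, and each layer from 1 to \<open>j\<close> is a
      separator contributing at least \<open>\<kappa>\<close>.\<close>
    have below: "1 + \<kappa> * j \<le> card {x \<in> V. f x \<le> j}" if "w \<in> V" "j < f w" for w j
      using that(2)
    proof (induct j)
      case 0
      then show ?case using zero by simp
    next
      case (Suc j)
      have "{x \<in> V. f x \<le> Suc j} = {x \<in> V. f x \<le> j} \<union> {x \<in> V. f x = Suc j}" by auto
      then have "card {x \<in> V. f x \<le> Suc j} = card {x \<in> V. f x \<le> j} + card {x \<in> V. f x = Suc j}"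
        using finV by (simp add: card_Un_disjoint disjoint_iff)
      then show ?case using Suc layer[OF that(1), of "Suc j"] by simp
    qed
    have "(\<Sum>y\<in>{y \<in> V. 2 \<le> f y}. 1 + int \<kappa> * (int (f y) - 2)) \<le> int (card (skips V f))"
      unfolding card_skips[OF finV] of_nat_sum
    proof (rule sum_mono)
      fix y assume "y \<in> {y \<in> V. 2 \<le> f y}"
      then have "y \<in> V" "2 \<le> f y" by auto
      then have "int (1 + \<kappa> * (f y - 2)) \<le> int (card {x \<in> V. f x \<le> f y - 2})"
        using below[of y "f y - 2"] by (intro of_nat_mono) simp
      then show "1 + int \<kappa> * (int (f y) - 2) \<le> int (card {x \<in> V. f x \<le> f y - 2})"
        using \<open>2 \<le> f y\<close> by (simp add: of_nat_diff)
    qed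
    \<comment> \<open>The size of layer 1 enters with the factor
      \<open>\<kappa> - 1 \<ge> 0\<close>, so its lower bound \<open>\<kappa>\<close> may be
      inserted.\<close>
    moreover have "(int \<kappa> - 1) * int \<kappa> \<le> (int \<kappa> - 1) * int (card {y \<in> V. f y = 1})"
    proof (rule mult_left_mono)
      obtain w where "w \<in> V" "2 \<le> f w" using True by blast
      then show "int \<kappa> \<le> int (card {y \<in> V. f y = 1})" using layer[of w 1] by simp
    qed (use G(4) in simp)
    ultimately show ?thesis
      using arcs_le sum_above_layer_one[OF finV, of f "int \<kappa>"] zero
      by (simp add: N_def algebra_simps power2_eq_square)
  next
    case False
    have "(\<Sum>w\<in>V. int (f w)) = (\<Sum>w\<in>V - {v}. int (f w))"
      using f0 v finV by (intro sum.mono_neutral_right) (auto simp: V_def)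
    also have "\<dots> \<le> (\<Sum>w\<in>V - {v}. 1)"
      using False by (intro sum_mono) (simp, force)
    also have "\<dots> = N"
    proof -
      have "0 < card V" using v finV by (auto simp: V_def card_gt_0_iff)
      then show ?thesis using v finV by (simp add: V_def N_def of_nat_diff)
    qed
    finally have "(\<Sum>w\<in>V. int (f w)) \<le> N" .
    \<comment> \<open>With a distance sum of at most \<open>N\<close>, the factor after
      \<open>int \<kappa>\<close> is at least \<open>N + 1 - \<kappa>\<close>, which the order of
      the digraph makes nonnegative.\<close>
    moreover have "int \<kappa> \<le> N + 1"
      using G(3) vertex_connectivity_le_order[of G] by (simp add: N_def V_def)
    ultimately have "0 \<le> int \<kappa> * (2 * N - int \<kappa> + 1 - (\<Sum>w\<in>V. int (f w)))" by simp
    then show ?thesis using m by (simp add: N_def V_def)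
  qed
  then show ?thesis by (simp add: V_def N_def f_def)
qed

section \<open>Rounding the size and solving the bound for the distance sum\<close>

lemma rounded_size_eq:
  assumes "1 \<le> \<kappa>"
  shows "rounded_size \<kappa> n m = int m + ((int n - 1)\<^sup>2 - int m) mod int \<kappa>"
  unfolding rounded_size_def
proof (rule Least_equality)
  have sq: "(int n)\<^sup>2 - 2 * int n + 1 = (int n - 1)\<^sup>2"
    by (simp add: power2_eq_square algebra_simps)
  show "int m \<le> int m + ((int n - 1)\<^sup>2 - int m) mod int \<kappa> \<and>
    [int m + ((int n - 1)\<^sup>2 - int m) mod int \<kappa> = (int n)\<^sup>2 - 2 * int n + 1] (mod int \<kappa>)"
    using assms unfolding sq by (simp add: cong_def mod_add_right_eq)
  \<comment> \<open>The difference \<open>k - m\<close> is nonnegative and has the same residue as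
    \<open>(n - 1)^2 - m\<close>, hence is at least that residue.\<close>
  fix k assume k: "int m \<le> k \<and> [k = (int n)\<^sup>2 - 2 * int n + 1] (mod int \<kappa>)"
  then have "(k - int m) mod int \<kappa> = ((int n - 1)\<^sup>2 - int m) mod int \<kappa>"
    unfolding sq cong_def by (intro mod_diff_cong) simp_all
  moreover have "(k - int m) mod int \<kappa> \<le> k - int m"
    using k by (intro zmod_le_nonneg_dividend) simp
  ultimately show "int m + ((int n - 1)\<^sup>2 - int m) mod int \<kappa> \<le> k" by simp
qed

text \<open>Lets \<open>m\<close> be replaced by its rounded value as soon as an upper bound for
  \<open>m\<close> lies in the residue class of \<open>(n - 1)^2\<close>.\<close>

lemma rounded_size_le:
  assumes "1 \<le> \<kappa>" "int m \<le> k" "[k = (int n - 1)\<^sup>2] (mod int \<kappa>)"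
  shows "rounded_size \<kappa> n m \<le> k"
proof -
  have "((int n - 1)\<^sup>2 - int m) mod int \<kappa> = (k - int m) mod int \<kappa>"
    using assms(3) unfolding cong_def by (intro mod_diff_cong) simp_all
  also have "\<dots> \<le> k - int m" using assms(2) by (intro zmod_le_nonneg_dividend) simp
  finally show ?thesis unfolding rounded_size_eq[OF assms(1)] by simp
qed

text \<open>The last hypothesis is equality in \<open>size_le_of_distance_sum\<close> with size
  \<open>k\<close> and distance sum \<open>s\<close>. The bound at \<open>k\<close> is thus the
  average distance that equality would force.\<close>

lemma remoteness_bound_eq:
  assumes "1 \<le> \<kappa>" "2 \<le> n"
    and "int \<kappa> * s = (int n - 1)\<^sup>2 + int \<kappa> * (2 * (int n - 1) - int \<kappa> + 1) - k"
  shows "remoteness_bound \<kappa> n k = real_of_int s / (real n - 1)"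
proof -
  have "real_of_int (int \<kappa> * s)
      = real_of_int ((int n - 1)\<^sup>2 + int \<kappa> * (2 * (int n - 1) - int \<kappa> + 1) - k)"
    using assms(3) by simp
  then have "real \<kappa> * real_of_int s
      = (real n - 1)\<^sup>2 + real \<kappa> * (2 * (real n - 1) - real \<kappa> + 1) - real_of_int k"
    by simp
  then have k: "real_of_int k
      = (real n - 1)\<^sup>2 + real \<kappa> * (2 * (real n - 1) - real \<kappa> + 1) - real \<kappa> * real_of_int s"
    by simp
  define N where "N = real n - 1"
  have "N \<noteq> 0" "real \<kappa> \<noteq> 0" "real n = N + 1" using assms by (auto simp: N_def)
  then show ?thesis unfolding remoteness_bound_def k
    by (simp add: field_simps power2_eq_square)
qed

lemma remoteness_bound_mono:
  assumes "1 \<le> \<kappa>" "2 \<le> n" "k \<le> l"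
  shows "remoteness_bound \<kappa> n l \<le> remoteness_bound \<kappa> n k"
  using assms by (auto simp: remoteness_bound_def intro!: divide_right_mono)

lemma remoteness_le:
  assumes G: "digraph G" "strongly_connected G" "connected_of_degree \<kappa> G" "1 \<le> \<kappa>"
    and n: "card (verts G) = n" "2 \<le> n"
    and m: "card (arcs G) = m" "int m \<le> (int n - 1)\<^sup>2"
  shows "remoteness G \<le> remoteness_bound \<kappa> n (rounded_size \<kappa> n m)"
proof -
  have fin: "finite (verts G)" using G(1) by (simp add: digraph_def fin_digraph.finite_verts)
  have "average_distance_from G v \<le> remoteness_bound \<kappa> n (rounded_size \<kappa> n m)"
    if v: "v \<in> verts G" for v
  proof -
    define s where "s = (\<Sum>w\<in>verts G. int (distance G v w))"
    \<comment> \<open>The size at which the distance sum \<open>s\<close> would be tight, so the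
      bound at \<open>k\<close> is exactly the average distance from \<open>v\<close>.\<close>
    define k where "k = (int n - 1)\<^sup>2 + int \<kappa> * (2 * (int n - 1) - int \<kappa> + 1 - s)"
    have "int m \<le> k"
      using size_le_of_distance_sum[of G \<kappa> v] G n m v by (simp add: connected_of_degree_def s_def k_def)
    moreover have "[k = (int n - 1)\<^sup>2] (mod int \<kappa>)" by (simp add: k_def cong_def)
    ultimately have "rounded_size \<kappa> n m \<le> k" using rounded_size_le G(4) by blast
    then have "remoteness_bound \<kappa> n k \<le> remoteness_bound \<kappa> n (rounded_size \<kappa> n m)"
      using remoteness_bound_mono G(4) n by blast
    moreover have "remoteness_bound \<kappa> n k = real_of_int s / (real n - 1)"
      using G(4) n by (intro remoteness_bound_eq) (simp_all add: k_def algebra_simps)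
    moreover have "average_distance_from G v = real_of_int s / (real n - 1)"
      by (simp add: average_distance_from_def s_def n)
    ultimately show ?thesis by simp
  qed
  moreover have "verts G \<noteq> {}" using G(2) by (simp add: strongly_connected_def)
  ultimately show ?thesis unfolding remoteness_def using fin by simp
qed

section \<open>Layered digraphs\<close>

text \<open>No shortest path from 0 uses an arc into 0, so \<open>R\<close> adjusts the size without
  changing the distances from 0. Arcs are the pairs themselves, which rules out multiple
  arcs.\<close>

definition layered_digraph :: "nat \<Rightarrow> (nat \<Rightarrow> nat) \<Rightarrow> nat set \<Rightarrow> (nat, nat \<times> nat) pre_digraph" where
  "layered_digraph N f R =
     \<lparr>verts = {..N}, arcs = {(x, y) \<in> {..N} \<times> {..N}. x \<noteq> y \<and> f y \<le> f x + 1} - R \<times> {0},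
      tail = fst, head = snd\<rparr>"

lemma layered_digraph_simps [simp]:
  "verts (layered_digraph N f R) = {..N}"
  "arcs (layered_digraph N f R) = {(x, y) \<in> {..N} \<times> {..N}. x \<noteq> y \<and> f y \<le> f x + 1} - R \<times> {0}"
  "tail (layered_digraph N f R) = fst"
  "head (layered_digraph N f R) = snd"
  by (simp_all add: layered_digraph_def)

lemma arcs_ends_layered_digraph:
  "arcs_ends (layered_digraph N f R) = arcs (layered_digraph N f R)"
  by (simp add: arcs_ends_conv)

lemma digraph_layered_digraph: "digraph (layered_digraph N f R)"
proof
  show "finite (arcs (layered_digraph N f R))"
    by (rule finite_subset[of _ "{..N} \<times> {..N}"]) auto
qed (auto simp: arc_to_ends_def)

text \<open>Fewer than \<open>\<kappa>\<close> deletions leave a survivor in layer 1 and in every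
  positive layer below a nonempty one. A target \<open>w \<noteq> 0\<close> is reached directly or
  through a survivor of the layer before it; 0 is reached from a survivor of layer 1, whose arc into
  0 is not removed by \<open>R\<close>.\<close>

lemma strongly_connected_layered_digraph:
  assumes layer: "\<And>w i. w \<le> N \<Longrightarrow> 0 < i \<Longrightarrow> i < f w \<Longrightarrow> \<kappa> \<le> card {x \<in> {..N}. f x = i}"
    and layer1: "\<kappa> \<le> card {x \<in> {..N}. f x = 1}"
    and f0: "\<And>x. x \<le> N \<Longrightarrow> f x = 0 \<longleftrightarrow> x = 0"
    and R: "\<And>x. x \<in> R \<Longrightarrow> f x \<noteq> 1"
    and S: "S \<subseteq> {..N}" "card S < \<kappa>"
  shows "strongly_connected (layered_digraph N f R \<restriction> ({..N} - S))"
proof -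
  let ?D = "layered_digraph N f R" and ?A = "{..N} - S"
  interpret D: digraph ?D by (rule digraph_layered_digraph)
  interpret H: wf_digraph "?D \<restriction> ?A" by (rule D.wellformed_induce_subgraph)
  have finS: "finite S" using S finite_subset by blast
  have survivor: "\<exists>z\<in>?A. f z = i" if "\<kappa> \<le> card {x \<in> {..N}. f x = i}" for i
  proof (rule ccontr)
    assume "\<not> ?thesis"
    then have "{x \<in> {..N}. f x = i} \<subseteq> S" by auto
    then have "card {x \<in> {..N}. f x = i} \<le> card S" by (rule card_mono[OF finS])
    then show False using that S by simp
  qed
  obtain z1 where z1: "z1 \<in> ?A" "f z1 = 1" using survivor layer1 by blast
  have dom: "x \<rightarrow>\<^bsub>?D \<restriction> ?A\<^esub> y" if "x \<in> ?A" "y \<in> ?A" "x \<noteq> y" "f y \<le> f x + 1" "(x, y) \<notin> R \<times> {0}" for x y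
    using that by (auto simp: arcs_ends_conv image_iff)
  have reach: "u \<rightarrow>\<^sup>*\<^bsub>?D \<restriction> ?A\<^esub> w" if "u \<in> ?A" "w \<in> ?A" "w \<noteq> 0" for u w
    using that
  proof (induct "f w" arbitrary: w rule: less_induct)
    case less
    show ?case
    proof (cases "f w \<le> f u + 1")
      case True
      then show ?thesis
        using less.prems dom[of u w] by (cases "u = w") auto
    next
      case False
      \<comment> \<open>Here \<open>f w \<ge> 2\<close>, so layer \<open>f w - 1\<close> lies
        strictly between layers 0 and \<open>f w\<close>, and its survivor is not 0.\<close>
      then have "\<kappa> \<le> card {x \<in> {..N}. f x = f w - 1}"
        using less.prems by (intro layer[of w]) auto
      then obtain z where z: "z \<in> ?A" "f z = f w - 1" using survivor by blast
      then have "z \<noteq> 0" using False f0[of z] by auto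
      moreover have "f z < f w" using z False by simp
      ultimately have "u \<rightarrow>\<^sup>*\<^bsub>?D \<restriction> ?A\<^esub> z" using less.hyps z less.prems by blast
      moreover have "z \<rightarrow>\<^bsub>?D \<restriction> ?A\<^esub> w"
        using z less.prems False by (intro dom) auto
      ultimately show ?thesis by (rule H.reachable_adj_trans)
    qed
  qed
  have "u \<rightarrow>\<^sup>*\<^bsub>?D \<restriction> ?A\<^esub> w" if uw: "u \<in> ?A" "w \<in> ?A" for u w
  proof (cases "w = 0")
    case True
    have "z1 \<noteq> 0" using z1 f0[of z1] by auto
    then have "u \<rightarrow>\<^sup>*\<^bsub>?D \<restriction> ?A\<^esub> z1" using reach uw z1 by blast
    moreover have "z1 \<rightarrow>\<^bsub>?D \<restriction> ?A\<^esub> w"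
      using z1 uw True \<open>z1 \<noteq> 0\<close> R[of z1] f0[of 0] by (intro dom) auto
    ultimately show ?thesis by (rule H.reachable_adj_trans)
  next
    case False
    then show ?thesis using reach uw by blast
  qed
  then show ?thesis using z1(1) by (auto simp: strongly_connected_def)
qed

text \<open>As \<open>f 0 = 0\<close>, every pair \<open>(x, 0)\<close> with \<open>x\<close> in
  \<open>R\<close> skips no layer, so the removal costs exactly \<open>card R\<close> arcs.\<close>

lemma card_arcs_layered_digraph:
  assumes "R \<subseteq> {1..N}" "f 0 = 0"
  shows "int (card (arcs (layered_digraph N f R)))
    = (int N + 1) * int N - int (card (skips {..N} f)) - int (card R)"
proof -
  let ?P = "{(x, y) \<in> {..N} \<times> {..N}. x \<noteq> y \<and> f y \<le> f x + 1}"
  have "finite ?P" by (rule finite_subset[of _ "{..N} \<times> {..N}"]) auto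
  moreover have "R \<times> {0} \<subseteq> ?P" using assms by fastforce
  ultimately have "int (card (?P - R \<times> {0})) = int (card ?P) - int (card (R \<times> {0::nat}))"
    by (simp add: card_Diff_subset finite_subset card_mono of_nat_diff)
  moreover have "card (R \<times> {0::nat}) = card R" by (simp add: card_cartesian_product)
  ultimately show ?thesis
    using card_potential_pairs[of "{..N}" f] by (simp add: algebra_simps)
qed

text \<open>The layer index is a potential along arcs. In the tight construction the reverse
  estimate, for the sum, comes from \<open>remoteness_le\<close>.\<close>

lemma layer_le_distance:
  assumes "strongly_connected (layered_digraph N f R)" "x \<le> N" "f 0 = 0"
  shows "f x \<le> distance (layered_digraph N f R) 0 x"
proof -
  interpret digraph "layered_digraph N f R" by (rule digraph_layered_digraph)
  have "0 \<rightarrow>\<^sup>*\<^bsub>layered_digraph N f R\<^esub> x"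
    using assms by (simp add: strongly_connected_def)
  then have "f x \<le> f 0 + distance (layered_digraph N f R) 0 x"
    by (rule potential_le_distance) (auto simp: arcs_ends_layered_digraph)
  then show ?thesis using assms by simp
qed

section \<open>Layerings with a prescribed sum of layer indices\<close>

text \<open>The quotient is \<open>x / \<kappa>\<close> rounded up: the layer of \<open>x\<close>
  when 0 stands alone and the later vertices fill layers of \<open>\<kappa>\<close> in
  order.\<close>

lemma ceiling_div_le_iff:
  fixes x \<kappa> j :: nat
  assumes "1 \<le> \<kappa>"
  shows "(x + \<kappa> - 1) div \<kappa> \<le> j \<longleftrightarrow> x \<le> \<kappa> * j"
proof -
  have "(x + \<kappa> - 1) div \<kappa> \<le> j \<longleftrightarrow> (x + \<kappa> - 1) div \<kappa> < Suc j" by (rule less_Suc_eq_le[symmetric])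
  also have "\<dots> \<longleftrightarrow> x + \<kappa> - 1 < Suc j * \<kappa>" using assms by (intro div_less_iff_less_mult) simp
  also have "\<dots> \<longleftrightarrow> x \<le> \<kappa> * j" using assms by (auto simp: algebra_simps)
  finally show ?thesis .
qed

text \<open>The sum of layer indices for layers of sizes 1, \<open>\<kappa>\<close>, ...,
  \<open>\<kappa>\<close>, \<open>b\<close>, doubled to avoid division.\<close>

lemma sum_ceiling_div:
  fixes \<kappa> k b :: nat
  assumes "1 \<le> \<kappa>" "b \<le> \<kappa>"
  shows "2 * (\<Sum>x\<le>k * \<kappa> + b. (x + \<kappa> - 1) div \<kappa>) = \<kappa> * k * (k + 1) + 2 * b * (k + 1)"
  using assms(2)
proof (induct k arbitrary: b)
  case 0
  then show ?case
  proof (induct b)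
    case 0
    then show ?case using assms(1) by simp
  next
    case (Suc b)
    have "(Suc b + \<kappa> - 1) div \<kappa> = 1"
      using Suc.prems assms(1) by (intro div_nat_eqI) auto
    then show ?case using Suc by simp
  qed
next
  case (Suc k)
  from Suc.prems show ?case
  proof (induct b)
    case 0
    \<comment> \<open>An empty new layer is the preceding case with its last layer full,
      \<open>b = \<kappa>\<close>.\<close>
    show ?case using Suc.hyps[of \<kappa>] by (simp add: algebra_simps)
  next
    case (Suc b)
    have "(Suc k * \<kappa> + Suc b + \<kappa> - 1) div \<kappa> = k + 2"
      using Suc.prems assms(1) by (intro div_nat_eqI) (auto simp: algebra_simps)
    then show ?case using Suc by (simp add: algebra_simps)
  qed
qed

lemma sum_less_indicator: "(\<Sum>x\<le>N. if q < x then 1 else 0 :: nat) = N - q"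
proof -
  have "(\<Sum>x\<le>N. if q < x then 1 else 0 :: nat) = card ({..N} \<inter> {x. q < x})"
    by (simp flip: sum.inter_filter add: Int_def)
  also have "{..N} \<inter> {x. q < x} = {q<..N}" by auto
  finally show ?thesis by simp
qed

text \<open>
  Start from all vertices in layers 0, ..., d - 1, with the last layer taking up the whole
  remainder, and push vertices from layer d - 1 to layer d one at a time: the sum grows by one
  at each step, and when the pushed vertices leave \<open>\<kappa>\<close> of them behind, d can be increased.
\<close>

lemma ex_layering:
  fixes \<kappa> N s :: nat
  assumes \<kappa>: "1 \<le> \<kappa>" and N: "\<kappa> \<le> N"
    and s: "2 * N - \<kappa> < s" "s \<le> (\<Sum>x\<le>N. (x + \<kappa> - 1) div \<kappa>)"
  shows "\<exists>f d. 3 \<le> d \<and> \<kappa> * (d - 1) < N \<and> (\<Sum>x\<le>N. f x) = s \<and> (\<forall>x. f x \<le> d)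
    \<and> (\<forall>j \<le> d - 2. \<forall>x. f x \<le> j \<longleftrightarrow> x \<le> \<kappa> * j) \<and> \<kappa> \<le> card {x \<in> {..N}. f x = d - 1}"
proof -
  define L where "L x = (x + \<kappa> - 1) div \<kappa>" for x
  \<comment> \<open>Layer indices capped at \<open>e\<close>. Raising the cap lifts exactly the
    vertices \<open>x > \<kappa> * e\<close> by one layer.\<close>
  define g where "g e = (\<Sum>x\<le>N. min (L x) e)" for e
  have L_le: "L x \<le> j \<longleftrightarrow> x \<le> \<kappa> * j" for x j
    unfolding L_def using \<kappa> by (rule ceiling_div_le_iff)
  have g_Suc: "g (Suc e) = g e + (N - \<kappa> * e)" for e
  proof -
    have "g (Suc e) = (\<Sum>x\<le>N. min (L x) e + (if \<kappa> * e < x then 1 else 0))"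
      unfolding g_def
    proof (intro sum.cong refl)
      fix x
      show "min (L x) (Suc e) = min (L x) e + (if \<kappa> * e < x then 1 else 0)"
        using L_le[of x e] by auto
    qed
    then show ?thesis by (simp add: sum.distrib sum_less_indicator g_def)
  qed
  have g0: "g 0 = 0" by (simp add: g_def)
  have "g N = (\<Sum>x\<le>N. L x)"
    unfolding g_def
  proof (intro sum.cong refl)
    fix x assume "x \<in> {..N}"
    then have "L x \<le> N" unfolding L_le using \<kappa> by (metis atMost_iff le_trans mult_le_mono1 nat_mult_1)
    then show "min (L x) N = L x" by simp
  qed
  then have "s \<le> g N" using s(2) by (simp add: L_def)
  then have ex: "\<exists>e. s \<le> g e" by blast
  \<comment> \<open>The least sufficient depth, so that
    \<open>g (d - 1) < s \<le> g d\<close>.\<close>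
  define d where "d = (LEAST e. s \<le> g e)"
  have d: "s \<le> g d" unfolding d_def using ex by (rule LeastI_ex)
  have d_least: "g e < s" if "e < d" for e
    using not_less_Least[of e "\<lambda>e. s \<le> g e"] that by (simp add: d_def)
  \<comment> \<open>The value of \<open>g 2\<close> is where the lower limit on \<open>s\<close>
    comes from: it forces \<open>d \<ge> 3\<close>.\<close>
  have "g 1 = N" "g 2 = 2 * N - \<kappa>"
    using g_Suc[of 0] g_Suc[of 1] g0 N by (simp_all add: numeral_2_eq_2)
  then have "g 0 < s" "g 1 < s" "g 2 < s" using s(1) g0 N by auto
  then have "d \<noteq> 0" "d \<noteq> 1" "d \<noteq> 2" using d by (metis not_less)+
  then have d3: "3 \<le> d" by simp
  define t where "t = s - g (d - 1)"
  have gd: "g d = g (d - 1) + (N - \<kappa> * (d - 1))" using g_Suc[of "d - 1"] d3 by simp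
  have t: "0 < t" "t \<le> N - \<kappa> * (d - 1)" "s = g (d - 1) + t"
  proof -
    have "g (d - 1) < s" using d3 by (intro d_least) simp
    then show "0 < t" "s = g (d - 1) + t" by (simp_all add: t_def)
    then show "t \<le> N - \<kappa> * (d - 1)" using d gd by linarith
  qed
  \<comment> \<open>The last \<open>t\<close> vertices up to \<open>N\<close> move from layer
    \<open>d - 1\<close> to layer \<open>d\<close>, adding the missing \<open>t\<close> to the
    sum.\<close>
  define f where "f x = min (L x) (d - 1) + (if N - t < x then 1 else 0)" for x
  \<comment> \<open>The moved vertices all lie beyond \<open>\<kappa> * (d - 1)\<close>, so layer
    \<open>d - 1\<close> keeps a full block of \<open>\<kappa>\<close>.\<close>
  have q: "\<kappa> * (d - 1) \<le> N - t" using t by simp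
  have "(\<Sum>x\<le>N. f x) = s"
    using t by (simp add: f_def sum.distrib sum_less_indicator g_def)
  moreover have "\<forall>x. f x \<le> d" using d3 by (auto simp: f_def)
  moreover have "f x \<le> j \<longleftrightarrow> x \<le> \<kappa> * j" if "j \<le> d - 2" for j x
  proof (cases "x \<le> N - t")
    case True
    then show ?thesis using that d3 L_le[of x j] by (auto simp: f_def min_def)
  next
    case False
    then have "\<kappa> * (d - 1) < x" using q by simp
    moreover have "\<kappa> * j \<le> \<kappa> * (d - 1)" using that by (intro mult_le_mono2) linarith
    ultimately have "\<kappa> * j < x" by (rule le_less_trans[rotated])
    moreover have "d - 1 < L x" using \<open>\<kappa> * (d - 1) < x\<close> L_le[of x "d - 1"] by simp
    then have "f x = d" using False d3 by (simp add: f_def)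
    ultimately show ?thesis using that d3 by linarith
  qed
  moreover have "\<kappa> \<le> card {x \<in> {..N}. f x = d - 1}"
  proof -
    have "f x = d - 1" "x \<le> N" if "x \<in> {\<kappa> * (d - 2)<..\<kappa> * (d - 1)}" for x
      using that q L_le[of x "d - 2"] d3 by (auto simp: f_def)
    then have "card {\<kappa> * (d - 2)<..\<kappa> * (d - 1)} \<le> card {x \<in> {..N}. f x = d - 1}"
      by (intro card_mono) auto
    moreover have "d - 1 = Suc (d - 2)" using d3 by simp
    ultimately show ?thesis by simp
  qed
  moreover have "\<kappa> * (d - 1) < N" using t by simp
  ultimately show ?thesis using d3 by blast
qed

text \<open>Take the layers from \<open>ex_layering\<close> and remove \<open>r\<close> arcs into 0.
  Since the layers from 1 to \<open>d - 2\<close> have exactly \<open>\<kappa>\<close> vertices, the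
  skip count meets the estimate behind the upper bound with equality.\<close>

lemma ex_layered_digraph:
  fixes \<kappa> N r s :: nat
  assumes \<kappa>: "1 \<le> \<kappa>" and N: "\<kappa> \<le> N" and r: "r < \<kappa>"
    and s: "2 * N - \<kappa> < s" "s \<le> (\<Sum>x\<le>N. (x + \<kappa> - 1) div \<kappa>)"
  shows "\<exists>D :: (nat, nat \<times> nat) pre_digraph. \<exists>v \<in> verts D.
    digraph D \<and> strongly_connected D \<and> \<kappa> \<le> vertex_connectivity D \<and> card (verts D) = N + 1 \<and>
    int (card (arcs D)) = (int N)\<^sup>2 + int \<kappa> * (2 * int N - int \<kappa> + 1) - int \<kappa> * int s - int r \<and>
    s \<le> (\<Sum>w\<in>verts D. distance D v w)"
proof -
  obtain f d where d: "3 \<le> d" "\<kappa> * (d - 1) < N" and sum: "(\<Sum>x\<le>N. f x) = s"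
    and fd: "\<And>x. f x \<le> d" and f: "\<And>j x. j \<le> d - 2 \<Longrightarrow> f x \<le> j \<longleftrightarrow> x \<le> \<kappa> * j"
    and last: "\<kappa> \<le> card {x \<in> {..N}. f x = d - 1}"
    using ex_layering[OF \<kappa> N s] by blast
  have dN: "\<kappa> * j \<le> N" if "j \<le> d - 1" for j
    using that d(2) by (meson le_trans less_imp_le mult_le_mono2)
  have f0: "f x = 0 \<longleftrightarrow> x = 0" for x using f[of 0 x] by simp
  have exact: "card {x \<in> {..N}. f x = Suc j} = \<kappa>" if j: "Suc j \<le> d - 2" for j
  proof -
    have "f x = Suc j \<longleftrightarrow> x \<in> {\<kappa> * j<..\<kappa> * Suc j}" for x
      using f[of j x] f[of "Suc j" x] j by auto
    moreover have "{\<kappa> * j<..\<kappa> * Suc j} \<subseteq> {..N}"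
    proof -
      have "\<kappa> * Suc j \<le> N" using j by (intro dN) simp
      then show ?thesis by auto
    qed
    ultimately have "{x \<in> {..N}. f x = Suc j} = {\<kappa> * j<..\<kappa> * Suc j}" by blast
    then show ?thesis by simp
  qed
  have layer: "\<kappa> \<le> card {x \<in> {..N}. f x = i}" if "0 < i" "i < f w" for w i
  proof (cases "i \<le> d - 2")
    case True
    then show ?thesis using exact[of "i - 1"] that by simp
  next
    case False
    then have "i = d - 1" using that fd[of w] by simp
    then show ?thesis using last by simp
  qed
  have layer1: "card {x \<in> {..N}. f x = 1} = \<kappa>" using exact[of 0] d by simp
  \<comment> \<open>These \<open>r\<close> tails lie beyond \<open>\<kappa>\<close>, hence outside
    layer 1, and within \<open>2 * \<kappa> \<le> N\<close>.\<close>
  define R where "R = {\<kappa><..\<kappa> + r}"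
  have "\<kappa> * 2 \<le> N" using dN[of 2] d by simp
  then have R: "R \<subseteq> {1..N}" "card R = r" using r by (auto simp: R_def)
  have "1 \<le> d - 2" using d by linarith
  then have Rf: "f x \<noteq> 1" if "x \<in> R" for x using f[of 1 x] that by (auto simp: R_def)
  define D where "D = layered_digraph N f R"
  have conn: "strongly_connected (D \<restriction> ({..N} - S))" if "S \<subseteq> {..N}" "card S < \<kappa>" for S
    unfolding D_def
    by (rule strongly_connected_layered_digraph) (use layer layer1 f0 Rf that in auto)
  have "D \<restriction> ({..N} - {}) = D"
    by (auto simp: D_def induce_subgraph_def intro!: pre_digraph.equality)
  then have sc: "strongly_connected D" using conn[of "{}"] \<kappa> by simp
  have vc: "\<kappa> \<le> vertex_connectivity D"
    by (rule le_vertex_connectivityI) (use conn in \<open>simp add: D_def\<close>)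
  have "int (card (skips {..N} f))
      = (\<Sum>y\<in>{y \<in> {..N}. 2 \<le> f y}. int (card {x \<in> {..N}. f x \<le> f y - 2}))"
    by (simp add: card_skips)
  \<comment> \<open>Since \<open>f y \<le> d\<close>, only layers up to \<open>d - 2\<close> are
    counted, and these have exact sizes.\<close>
  also have "\<dots> = (\<Sum>y\<in>{y \<in> {..N}. 2 \<le> f y}. 1 + int \<kappa> * (int (f y) - 2))"
  proof (intro sum.cong refl)
    fix y assume "y \<in> {y \<in> {..N}. 2 \<le> f y}"
    then have y: "2 \<le> f y" "f y - 2 \<le> d - 2" using fd[of y] by auto
    then have "f x \<le> f y - 2 \<longleftrightarrow> x \<in> {..\<kappa> * (f y - 2)}" for x
      using f[of "f y - 2" x] by simp
    moreover have "{..\<kappa> * (f y - 2)} \<subseteq> {..N}" using dN[of "f y - 2"] y by simp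
    ultimately have "{x \<in> {..N}. f x \<le> f y - 2} = {..\<kappa> * (f y - 2)}"
      by (simp add: set_eq_iff subset_iff) blast
    then show "int (card {x \<in> {..N}. f x \<le> f y - 2}) = 1 + int \<kappa> * (int (f y) - 2)"
      using y by (simp add: of_nat_diff)
  qed
  also have "\<dots> = int N + int \<kappa> * int s - 2 * int \<kappa> * int N + (int \<kappa> - 1) * int \<kappa>"
  proof -
    have "{y \<in> {..N}. f y = 0} = {0}" using f0 by auto
    moreover have "(\<Sum>y\<le>N. int (f y)) = int s" using sum by (simp flip: of_nat_sum)
    ultimately show ?thesis
      using sum_above_layer_one[of "{..N}" f "int \<kappa>"] layer1 by simp
  qed
  finally have "int (card (arcs D))
      = (int N)\<^sup>2 + int \<kappa> * (2 * int N - int \<kappa> + 1) - int \<kappa> * int s - int r"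
    using card_arcs_layered_digraph[OF R(1), of f] f0 R(2)
    by (simp add: D_def power2_eq_square algebra_simps)
  moreover have "s \<le> (\<Sum>w\<in>verts D. distance D 0 w)"
    unfolding sum[symmetric] using layer_le_distance[of N f R] sc f0
    by (auto simp: D_def intro!: sum_mono)
  moreover have "digraph D" unfolding D_def by (rule digraph_layered_digraph)
  moreover have "0 \<in> verts D" "card (verts D) = N + 1" by (simp_all add: D_def)
  ultimately show ?thesis using sc vc by blast
qed

text \<open>Solve the tight equation for the distance sum \<open>s\<close>, realise \<open>s\<close>
  by a layered digraph with \<open>r = M - m\<close> arcs removed, and squeeze:
  \<open>s / (n - 1)\<close> is at most the average distance from \<open>v\<close>, hence at most
  the remoteness, which is at most the bound \<open>s / (n - 1)\<close>.\<close>

lemma ex_remoteness_eq: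
  fixes \<kappa> n m b :: nat
  assumes \<kappa>: "1 \<le> \<kappa>" "\<kappa> < n" and b: "b \<in> {1..\<kappa>}" "[int b = int n - 1] (mod int \<kappa>)"
    and m: "int m \<le> (int n - 1)\<^sup>2"
    and long: "longest_layered_size \<kappa> n b \<le> real_of_int (rounded_size \<kappa> n m)"
  shows "\<exists>D :: (nat, nat \<times> nat) pre_digraph.
    digraph D \<and> strongly_connected D \<and> connected_of_degree \<kappa> D \<and>
    card (verts D) = n \<and> card (arcs D) = m \<and>
    remoteness D = remoteness_bound \<kappa> n (rounded_size \<kappa> n m)"
proof -
  define N where "N = n - 1"
  have n: "n = N + 1" "\<kappa> \<le> N" using \<kappa> by (auto simp: N_def)
  define M where "M = rounded_size \<kappa> n m"
  have M: "M = int m + ((int N)\<^sup>2 - int m) mod int \<kappa>"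
    using rounded_size_eq[OF \<kappa>(1), of n m] by (simp add: M_def n)
  have "M \<le> (int N)\<^sup>2"
    unfolding M_def using m by (intro rounded_size_le \<kappa>) (simp_all add: n)
  have "int \<kappa> dvd (int N)\<^sup>2 - M"
    unfolding M by (simp add: diff_diff_eq[symmetric] minus_mod_eq_mult_div)
  then obtain t where t: "(int N)\<^sup>2 - M = int \<kappa> * t" by blast
  then have "0 \<le> t" using \<open>M \<le> (int N)\<^sup>2\<close> \<kappa>(1) zero_le_mult_iff[of "int \<kappa>" t] by linarith
  \<comment> \<open>Equality in \<open>size_le_of_distance_sum\<close> at size \<open>M\<close>,
    solvable in integers by the residue class of \<open>M\<close>; \<open>t \<ge> 0\<close> puts
    \<open>s\<close> above \<open>2 * N - \<kappa>\<close>.\<close>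
  define s where "s = nat (t + 2 * int N - int \<kappa> + 1)"
  have s: "int s = t + 2 * int N - int \<kappa> + 1" using \<open>0 \<le> t\<close> n by (simp add: s_def)
  have Ms: "M = (int N)\<^sup>2 + int \<kappa> * (2 * int N - int \<kappa> + 1) - int \<kappa> * int s"
    using t unfolding s by (simp add: algebra_simps)
  have s1: "2 * N - \<kappa> < s" using s \<open>0 \<le> t\<close> n by linarith
  have s2: "s \<le> (\<Sum>x\<le>N. (x + \<kappa> - 1) div \<kappa>)"
  proof -
    have "int \<kappa> dvd int N - int b"
      using b(2) n by (simp add: cong_iff_dvd_diff dvd_diff_commute)
    then have "\<kappa> dvd N - b" using b(1) n by (simp flip: int_dvd_int_iff add: of_nat_diff)
    then obtain k where "N - b = \<kappa> * k" by blast
    then have "N = \<kappa> * k + b" using b(1) n by (simp split: nat_diff_split_asm)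
    then have k: "N = k * \<kappa> + b" by (simp only: mult.commute)
    define T where "T = (\<Sum>x\<le>N. (x + \<kappa> - 1) div \<kappa>)"
    have "2 * T = \<kappa> * k * (k + 1) + 2 * b * (k + 1)"
      unfolding T_def k using sum_ceiling_div[of \<kappa> b k] \<kappa> b(1) by simp
    then have T: "2 * real T = real \<kappa> * real k * (real k + 1) + 2 * real b * (real k + 1)"
      by (metis (mono_tags, opaque_lifting) of_nat_1 of_nat_add of_nat_mult of_nat_numeral)
    have "real_of_int M
        = (real N)\<^sup>2 + real \<kappa> * (2 * real N - real \<kappa> + 1) - real \<kappa> * real s"
      unfolding Ms by simp
    then have "2 * longest_layered_size \<kappa> n b
        \<le> 2 * ((real N)\<^sup>2 + real \<kappa> * (2 * real N - real \<kappa> + 1) - real \<kappa> * real s)"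
      using long by (simp add: M_def)
    \<comment> \<open>With \<open>T\<close> in place of \<open>s\<close>, the right side before is
      exactly \<open>2 * longest_layered_size \<kappa> n b\<close>, so \<open>long\<close> amounts
      to \<open>s \<le> T\<close>.\<close>
    then have "real \<kappa> * (2 * real s) \<le> real \<kappa> * (2 * real T)"
      unfolding T longest_layered_size_def n(1) k
      by (simp add: algebra_simps power2_eq_square add_divide_distrib diff_divide_distrib)
    then show ?thesis using \<kappa> unfolding T_def[symmetric] by simp
  qed
  define r where "r = nat (M - int m)"
  have "0 \<le> M - int m" "M - int m < int \<kappa>" using M \<kappa> by simp_all
  then have r: "r < \<kappa>" "int r = M - int m" by (auto simp: r_def)
  obtain D :: "(nat, nat \<times> nat) pre_digraph" and v where D: "v \<in> verts D" "digraph D"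
    "strongly_connected D" "\<kappa> \<le> vertex_connectivity D" "card (verts D) = n"
    "int (card (arcs D)) = M - int r" "s \<le> (\<Sum>w\<in>verts D. distance D v w)"
    using ex_layered_digraph[OF \<kappa>(1) n(2) r(1) s1 s2] unfolding Ms n(1) by blast
  have arcs: "card (arcs D) = m" using D(6) r(2) by simp
  have fin: "finite (verts D)" using D(2) by (simp add: digraph_def fin_digraph.finite_verts)
  have cd: "connected_of_degree \<kappa> D" using D(4) by (simp add: connected_of_degree_def)
  have "remoteness D \<le> remoteness_bound \<kappa> n M"
    unfolding M_def using \<kappa> m arcs D cd by (intro remoteness_le) auto
  moreover have "remoteness_bound \<kappa> n M = real_of_int (int s) / (real n - 1)"
    using \<kappa> by (intro remoteness_bound_eq) (auto simp: Ms n(1))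
  moreover have "real s / (real n - 1) \<le> average_distance_from D v"
  proof -
    have "real s \<le> (\<Sum>w\<in>verts D. real (distance D v w))"
      using D(7) by (simp flip: of_nat_sum)
    then show ?thesis
      using D(5) \<kappa> by (auto simp: average_distance_from_def intro!: divide_right_mono)
  qed
  moreover have "average_distance_from D v \<le> remoteness D"
    unfolding remoteness_def using fin D(1) by simp
  ultimately show ?thesis using D cd arcs unfolding M_def by (intro exI[of _ D]) auto
qed

theorem corollary3p3:
  fixes \<kappa> n m b :: nat and mstar :: int
  assumes "1 \<le> \<kappa>"
    and "b \<in> {1..\<kappa>}" and "[int b = int n - 1] (mod int \<kappa>)"
    and "real n / 2 * (3 * real \<kappa> + real n) - real n - (real \<kappa>)\<^sup>2
           - real b * (real \<kappa> - real b) \<le> real m"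
    and "int m \<le> (int n)\<^sup>2 - 2 * int n - 1"
    and "mstar = rounded_size \<kappa> n m"
  shows "(\<forall>D :: ('a, 'b) pre_digraph.
            digraph D \<and> strongly_connected D \<and> connected_of_degree \<kappa> D \<and>
            card (verts D) = n \<and> card (arcs D) = m \<longrightarrow>
            remoteness D \<le> remoteness_bound \<kappa> n mstar)
       \<and> (\<kappa> < n \<and> longest_layered_size \<kappa> n b \<le> real_of_int mstar \<longrightarrow>
            (\<exists>D :: (nat, nat \<times> nat) pre_digraph.
              digraph D \<and> strongly_connected D \<and> connected_of_degree \<kappa> D \<and>
              card (verts D) = n \<and> card (arcs D) = m \<and>
              remoteness D = remoteness_bound \<kappa> n mstar))"
proof -
  have m: "int m \<le> (int n - 1)\<^sup>2"
    using assms(5) by (simp add: power2_eq_square algebra_simps)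
  \<comment> \<open>For \<open>n \<le> 1\<close> the upper limit on \<open>m\<close> is negative.
    The bound divides by \<open>n - 1\<close>.\<close>
  have "2 \<le> n"
  proof (rule ccontr)
    assume "\<not> 2 \<le> n"
    then have "n = 0 \<or> n = 1" by auto
    then show False using assms(5) by auto
  qed
  then show ?thesis
    using assms m remoteness_le ex_remoteness_eq by blast
qed

end
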